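(* Let $A\in\mathsf{S}^{k}(\mathbb{C}^{n})$ be a symmetric tensor. Then there exist $\mathbf{y}_1,\dots,\mathbf{y}_s\in\mathbb{C}^n$ such that $$A=\sum_{i=1}^{s}\mathbf{y}_i^{\otimes k}.$$
   Context: $\mathsf{T}^k(\mathbb{C}^n)=\mathbb{C}^n\otimes\cdots\otimes\mathbb{C}^n$ ($k$ copies). The symmetric group $\mathfrak{S}_k$ acts linearly on $\mathsf{T}^k(\mathbb{C}^n)$ by $\sigma(\mathbf{x}_{1}\otimes\cdots\otimes\mathbf{x}_{k})=\mathbf{x}_{\sigma(1)}\otimes\cdots\otimes\mathbf{x}_{\sigma(k)}$. $\mathsf{S}^k(\mathbb{C}^n)$ is the subspace of symmetric tensors, i.e. those $A\in\mathsf{T}^k(\mathbb{C}^n)$ with $\sigma(A)=A$ for all $\sigma\in\mathfrak{S}_k$. For $\mathbf{y}\in\mathbb{C}^n$, $\mathbf{y}^{\otimes k}=\mathbf{y}\otimes\cdots\otimes\mathbf{y}$ ($k$ copies). Here $k,n\ge 1$. *)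

theory Defs
  imports "HOL-Analysis.Analysis"
begin

text \<open>
  The \<open>k\<close>-fold tensor power of \<open>\<complex>\<^sup>n\<close> is modelled by its coordinates in the basis
  \<open>e\<^bsub>f(1)\<^esub> \<otimes> \<dots> \<otimes> e\<^bsub>f(k)\<^esub>\<close>, where \<open>f\<close> ranges over the multi-indices
  \<open>{1..k} \<rightarrow> {1..n}\<close>. The finite index types \<open>'k\<close> and \<open>'n\<close> stand for \<open>{1..k}\<close> and \<open>{1..n}\<close>,
  so that \<open>k = CARD('k) \<ge> 1\<close> and \<open>n = CARD('n) \<ge> 1\<close>.
\<close>

type_synonym ('n, 'k) tensor = "(complex, 'k \<Rightarrow> 'n) vec"

definition tensor_prod :: "('k \<Rightarrow> complex ^ 'n) \<Rightarrow> ('n::finite, 'k::finite) tensor"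
  where "tensor_prod x = (\<chi> f. \<Prod>i\<in>UNIV. x i $ f i)"

definition tensor_pow :: "complex ^ 'n \<Rightarrow> ('n::finite, 'k::finite) tensor"
  where "tensor_pow y = tensor_prod (\<lambda>_. y)"

text \<open>
  The inverse makes \<open>perm_tensor \<sigma>\<close> send \<open>x\<^sub>1 \<otimes> \<dots> \<otimes> x\<^sub>k\<close> to
  \<open>x\<^bsub>\<sigma>(1)\<^esub> \<otimes> \<dots> \<otimes> x\<^bsub>\<sigma>(k)\<^esub>\<close>. The lemmas below show that it is the only linear map
  that does so.
\<close>

definition perm_tensor :: "('k \<Rightarrow> 'k) \<Rightarrow> ('n::finite, 'k::finite) tensor \<Rightarrow> ('n, 'k) tensor"
  where "perm_tensor \<sigma> A = (\<chi> f. A $ (f \<circ> inv \<sigma>))"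

definition symmetric_tensors :: "('n::finite, 'k::finite) tensor set"
  where "symmetric_tensors = {A. \<forall>\<sigma>. \<sigma> permutes UNIV \<longrightarrow> perm_tensor \<sigma> A = A}"

lemma tensor_prod_axis: "tensor_prod (\<lambda>i. axis (f i) 1) = axis f 1"
proof -
  have "(\<Prod>i\<in>UNIV. axis (f i) (1::complex) $ g i) = axis f 1 $ g" for g
  proof (cases "g = f")
    case False
    then obtain i where "g i \<noteq> f i" by blast
    then have "axis (f i) (1::complex) $ g i = 0" by (simp add: axis_def)
    then have "(\<Prod>i\<in>UNIV. axis (f i) (1::complex) $ g i) = 0"
      by (intro prod_zero) auto
    with False show ?thesis by (simp add: axis_def)
  qed (simp add: axis_def)
  then show ?thesis by (simp add: tensor_prod_def vec_eq_iff)
qed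

lemma linear_perm_tensor: "Vector_Spaces.linear (*s) (*s) (perm_tensor \<sigma>)"
  by unfold_locales (simp_all add: perm_tensor_def vec_eq_iff algebra_simps)

lemma perm_tensor_tensor_prod:
  assumes "\<sigma> permutes UNIV"
  shows "perm_tensor \<sigma> (tensor_prod x) = tensor_prod (x \<circ> \<sigma>)"
proof -
  have "bij \<sigma>" using assms by (rule permutes_bij)
  have "(\<Prod>i\<in>UNIV. x i $ f (inv \<sigma> i)) = (\<Prod>i\<in>UNIV. x (\<sigma> i) $ f i)" for f
    using prod.reindex_bij_betw[OF \<open>bij \<sigma>\<close>, of "\<lambda>i. x i $ f (inv \<sigma> i)"] \<open>bij \<sigma>\<close>
    by (simp add: bij_is_inj)
  then show ?thesis by (simp add: perm_tensor_def tensor_prod_def vec_eq_iff)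
qed

lemma perm_tensor_unique:
  fixes L :: "('n::finite, 'k::finite) tensor \<Rightarrow> ('n, 'k) tensor"
  assumes \<sigma>: "\<sigma> permutes UNIV" and L: "Vector_Spaces.linear (*s) (*s) L"
    and prod: "\<And>x. L (tensor_prod x) = tensor_prod (x \<circ> \<sigma>)"
  shows "L = perm_tensor \<sigma>"
proof
  fix A :: "('n, 'k) tensor"
  interpret L: Vector_Spaces.linear "(*s)" "(*s)" L by (rule L)
  interpret P: Vector_Spaces.linear "(*s)" "(*s)" "perm_tensor \<sigma> :: ('n, 'k) tensor \<Rightarrow> _"
    by (rule linear_perm_tensor)
  have A: "A = (\<Sum>f\<in>UNIV. A $ f *s tensor_prod (\<lambda>i. axis (f i) 1))"
    by (simp add: tensor_prod_axis basis_expansion)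
  show "L A = perm_tensor \<sigma> A"
    by (subst (1 2) A) (simp add: L.sum L.scale P.sum P.scale prod perm_tensor_tensor_prod[OF \<sigma>])
qed

end

theory Submission imports Defs begin

text \<open>
  The proof is polarization. Summing the basis expansion of a symmetric tensor over all
  permutations of the tensor factors multiplies the tensor by \<open>k!\<close>, and it replaces each
  basis tensor \<open>x\<^sub>1 \<otimes> \<dots> \<otimes> x\<^sub>k\<close> by the permutation sum
  \<open>\<Sum>\<sigma>. x\<^bsub>\<sigma>(1)\<^esub> \<otimes> \<dots> \<otimes> x\<^bsub>\<sigma>(k)\<^esub>\<close>. The lemma \<open>polarization\<close> writes that sum as a combination
  with signs of the \<open>k\<close>-th powers of the partial sums of \<open>x\<^sub>1, \<dots>, x\<^sub>k\<close>; this is the formula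
  behind Ryser's expansion of the permanent. Hence \<open>k!\<close> times the tensor, and so the tensor
  itself, is a linear combination of powers. Since \<open>(z y)\<^bsup>\<otimes>k\<^esup> = z\<^sup>k y\<^bsup>\<otimes>k\<^esup>\<close> and every
  complex number has a \<open>k\<close>-th root, the coefficients can be moved into the vectors.
\<close>

lemma sum_Pow_alternating:
  fixes U :: "'a set"
  assumes "finite U"
  shows "(\<Sum>T\<in>Pow U. (- 1) ^ card T) = (if U = {} then 1 else 0 :: 'b::comm_ring_1)"
  using prod_add[OF assms, of "\<lambda>_. - 1 :: 'b" "\<lambda>_. 1"] assms by (simp add: power_0_left)

text \<open>
  Expanding the powers over \<open>i \<notin> T\<close> gives one term for every map \<open>\<tau>\<close> on the index set and every
  \<open>T\<close> disjoint from the range of \<open>\<tau>\<close>. The alternating sum over these \<open>T\<close> vanishes unless the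
  range is everything, so only the bijections survive (inclusion-exclusion).
\<close>

lemma polarization:
  fixes x :: "'k::finite \<Rightarrow> complex ^ 'n::finite"
  shows "(\<Sum>\<sigma> | \<sigma> permutes UNIV. tensor_prod (x \<circ> \<sigma>)) =
    (\<Sum>T\<in>UNIV. (- 1) ^ card T *s (tensor_pow (\<Sum>i\<in>-T. x i) :: ('n, 'k) tensor))"
proof -
  have "(\<Sum>\<sigma> | \<sigma> permutes UNIV. \<Prod>j\<in>UNIV. x (\<sigma> j) $ g j) =
      (\<Sum>T\<in>UNIV. (- 1) ^ card T * (\<Prod>j\<in>UNIV. \<Sum>i\<in>-T. x i $ g j))" for g :: "'k \<Rightarrow> 'n"
  proof -
    let ?p = "\<lambda>\<tau>. \<Prod>j\<in>UNIV. x (\<tau> j) $ g j"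
    have expand: "(\<Prod>j\<in>UNIV. \<Sum>i\<in>-T. x i $ g j) = (\<Sum>\<tau> | T \<subseteq> - range \<tau>. ?p \<tau>)" for T
    proof -
      have "PiE UNIV (\<lambda>_. - T) = {\<tau> :: 'k \<Rightarrow> 'k. T \<subseteq> - range \<tau>}"
        by (auto simp: PiE_def Pi_def)
      then show ?thesis
        by (subst prod_sum_PiE) simp_all
    qed
    have "(\<Sum>T\<in>UNIV. (- 1) ^ card T * (\<Prod>j\<in>UNIV. \<Sum>i\<in>-T. x i $ g j)) =
        (\<Sum>T\<in>UNIV. \<Sum>\<tau> | T \<subseteq> - range \<tau>. (- 1) ^ card T * ?p \<tau>)"
      by (simp add: expand sum_distrib_left)
    also have "\<dots> = (\<Sum>\<tau>\<in>UNIV. \<Sum>T\<in>Pow (- range \<tau>). (- 1) ^ card T * ?p \<tau>)"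
      using sum.swap_restrict[of "UNIV :: 'k set set" "UNIV :: ('k \<Rightarrow> 'k) set"
          "\<lambda>T \<tau>. (- 1) ^ card T * ?p \<tau>" "\<lambda>T \<tau>. T \<subseteq> - range \<tau>"]
      by (simp add: Pow_def)
    also have "\<dots> = (\<Sum>\<tau>\<in>UNIV. if surj \<tau> then ?p \<tau> else 0)"
      by (intro sum.cong refl) (auto simp: sum_Pow_alternating simp flip: sum_distrib_right)
    also have "\<dots> = (\<Sum>\<tau> | surj \<tau>. ?p \<tau>)"
      by (simp add: sum.If_cases)
    also have "{\<tau> :: 'k \<Rightarrow> 'k. surj \<tau>} = {\<tau>. \<tau> permutes UNIV}"
      by (auto simp: bij_def finite_UNIV_surj_inj permutes_surj intro!: bij_imp_permutes)
    finally show ?thesis by simp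
  qed
  then show ?thesis
    by (simp add: vec_eq_iff tensor_pow_def tensor_prod_def)
qed

lemma tensor_pow_scale:
  "tensor_pow (z *s y) = z ^ CARD('k) *s (tensor_pow y :: ('n::finite, 'k::finite) tensor)"
  by (simp add: tensor_pow_def tensor_prod_def vec_eq_iff prod.distrib)

text \<open>Each coefficient is absorbed into its vector as a \<open>k\<close>-th root.\<close>

lemma linear_combination_tensor_pow:
  fixes c :: "'a \<Rightarrow> complex" and v :: "'a \<Rightarrow> complex ^ 'n::finite"
  assumes "finite I"
  shows "\<exists>(s::nat) y. (\<Sum>i\<in>I. c i *s tensor_pow (v i)) =
    (\<Sum>i=1..s. tensor_pow (y i) :: ('n, 'k::finite) tensor)"
proof -
  have "\<forall>i. \<exists>z. z ^ CARD('k) = c i"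
    using exists_complex_root[of "CARD('k)"] by (metis zero_less_card_finite less_irrefl)
  then obtain z where z: "\<And>i. z i ^ CARD('k) = c i"
    by metis
  obtain h where "bij_betw h {1..card I} I"
    using ex_bij_betw_nat_finite_1[OF assms] by blast
  then have "(\<Sum>i\<in>I. c i *s tensor_pow (v i) :: ('n, 'k) tensor) =
      (\<Sum>i=1..card I. tensor_pow (z (h i) *s v (h i)))"
    by (simp add: tensor_pow_scale z flip: sum.reindex_bij_betw)
  then show ?thesis
    by (intro exI)
qed

text \<open>
  This is what symmetry gives: the basis expansion of \<open>A\<close> stays valid after any permutation of
  the factors, so the \<open>k!\<close> permuted expansions add up to \<open>k! A\<close>.
\<close>

lemma symmetric_tensor_expansion:
  fixes A :: "('n::finite, 'k::finite) tensor"
  assumes "A \<in> symmetric_tensors"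
  shows "fact CARD('k) *s A =
    (\<Sum>f\<in>UNIV. A $ f *s (\<Sum>\<sigma> | \<sigma> permutes UNIV. tensor_prod ((\<lambda>i. axis (f i) 1) \<circ> \<sigma>)))"
proof -
  have perm: "A = (\<Sum>f\<in>UNIV. A $ f *s tensor_prod ((\<lambda>i. axis (f i) 1) \<circ> \<sigma>))"
    if \<sigma>: "\<sigma> permutes UNIV" for \<sigma>
  proof -
    interpret P: Vector_Spaces.linear "(*s)" "(*s)" "perm_tensor \<sigma> :: ('n, 'k) tensor \<Rightarrow> _"
      by (rule linear_perm_tensor)
    have "A = perm_tensor \<sigma> (\<Sum>f\<in>UNIV. A $ f *s tensor_prod (\<lambda>i. axis (f i) 1))"
      using assms \<sigma> by (simp add: symmetric_tensors_def tensor_prod_axis basis_expansion)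
    then show ?thesis
      by (simp add: P.sum P.scale perm_tensor_tensor_prod[OF \<sigma>])
  qed
  have "fact CARD('k) *s A = (\<Sum>\<sigma> | \<sigma> permutes (UNIV :: 'k set). A)"
    unfolding vec_eq_iff sum_component by (simp add: card_permutations[OF refl finite])
  also have "\<dots> = (\<Sum>\<sigma> | \<sigma> permutes UNIV. \<Sum>f\<in>UNIV. A $ f *s tensor_prod ((\<lambda>i. axis (f i) 1) \<circ> \<sigma>))"
    by (intro sum.cong refl perm) simp
  also have "\<dots> = (\<Sum>f\<in>UNIV. A $ f *s (\<Sum>\<sigma> | \<sigma> permutes UNIV. tensor_prod ((\<lambda>i. axis (f i) 1) \<circ> \<sigma>)))"
    by (subst sum.swap) (simp add: vec.scale_sum_right)
  finally show ?thesis .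
qed

theorem lemma4p2:
  fixes A :: "('n::finite, 'k::finite) tensor"
  assumes "A \<in> symmetric_tensors"
  shows "\<exists>(s::nat) (y :: nat \<Rightarrow> complex ^ 'n). A = (\<Sum>i=1..s. tensor_pow (y i))"
proof -
  \<comment> \<open>A pair of a multi-index \<open>f\<close> and a set \<open>T\<close> of omitted summands labels each power that occurs.\<close>
  let ?c = "\<lambda>(f, T). A $ f * (- 1) ^ card T / fact CARD('k)"
  let ?v = "\<lambda>(f :: 'k \<Rightarrow> 'n, T). \<Sum>i\<in>-T. axis (f i) (1::complex)"
  have "A = (1 / fact CARD('k)) *s (fact CARD('k) *s A)"
    by (simp add: vector_smult_assoc)
  also have "\<dots> = (\<Sum>f\<in>UNIV. \<Sum>T\<in>UNIV. ?c (f, T) *s tensor_pow (?v (f, T)))"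
    by (simp add: symmetric_tensor_expansion[OF assms] polarization vec.scale_sum_right
        vector_smult_assoc)
  also have "\<dots> = (\<Sum>p\<in>UNIV. ?c p *s tensor_pow (?v p))"
    by (simp add: sum.cartesian_product split_def)
  finally show ?thesis
    using linear_combination_tensor_pow[of UNIV ?c ?v, where 'k = 'k] by simp
qed

end
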